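(* Let $e$ be a term of the simply-typed $\lambda$-calculus with numbers, control and prompt, let $\tau,\alpha,\beta$ be $\mathsf{CP}$ types, $\mu_1,\mu_2$ $\mathsf{CP}$ trail types and $\Gamma$ a $\mathsf{CP}$ type environment. (1) If $\Gamma\vdash_{\mathsf{CP}} e:\tau\,\langle\mu_1\rangle\,\alpha\,\langle\mu_2\rangle\,\beta$, then for every $\mathsf{4D}_{\mathsf{fun}}$ type $\gamma$, $$\Gamma^{C,\gamma}\vdash_{\mathsf{4Dfun}} e:\tau^{C,\gamma}\,\langle\mu_1^{C,\gamma},(\alpha^{C,\gamma}\to\gamma)\rangle\,\gamma\,\langle\mu_2^{C,\gamma},(\beta^{C,\gamma}\to\gamma)\rangle\,\gamma .$$ (2) If for some $\mathsf{4D}_{\mathsf{fun}}$ type $\gamma$ $$\Gamma^{C,\gamma}\vdash_{\mathsf{4Dfun}} e:\tau^{C,\gamma}\,\langle\mu_1^{C,\gamma},(\alpha^{C,\gamma}\to\gamma)\rangle\,\gamma\,\langle\mu_2^{C,\gamma},(\beta^{C,\gamma}\to\gamma)\rangle\,\gamma,$$ then $\Gamma\vdash_{\mathsf{CP}} e:\tau\,\langle\mu_1\rangle\,\alpha\,\langle\mu_2\rangle\,\beta$.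
   Context: Terms: $e ::= n \mid x \mid \lambda x.e \mid e_1e_2 \mid \mathcal{F}k.e$ (control) $\mid \langle e\rangle$ (prompt), $n$ a number. Type environments map variables to types of the system at hand. **System $\mathsf{CP}$** (Cong et al., derived from a 1CPS interpreter with trails). Types $\tau,\alpha,\beta,\dots ::= \mathbb{N}\mid\tau_1\to\tau_2\,\langle\mu_\alpha\rangle\,\alpha\,\langle\mu_\beta\rangle\,\beta$; trail types $\mu ::= \bullet_\mu\mid\tau_1\to\langle\mu\rangle\,\tau_2$. Constraints: id-cont-type$(\tau,\bullet_\mu,\tau')$ iff $\tau=\tau'$; id-cont-type$(\tau,(\tau_1\to\langle\mu_1\rangle\tau_1'),\tau')$ iff $\tau=\tau_1$, $\tau'=\tau_1'$, $\mu_1=\bullet_\mu$. compatible$(\bullet_\mu,\mu_2,\mu_3)$ iff $\mu_2=\mu_3$; compatible$((\tau_1\to\langle\mu_1\rangle\tau_1'),\bullet_\mu,\mu_3)$ iff $(\tau_1\to\langle\mu_1\rangle\tau_1')=\mu_3$; compatible of two non-empty trail types and $\bullet_\mu$ is false; compatible$((\tau_1\to\langle\mu_1\rangle\tau_1'),(\tau_2\to\langle\mu_2\rangle\tau_2'),(\tau_3\to\langle\mu_3\rangle\tau_3'))$ iff $\tau_1=\tau_3$, $\tau_1'=\tau_3'$ and compatible$((\tau_2\to\langle\mu_2\rangle\tau_2'),\mu_3,\mu_1)$. Rules: - if $x:\tau\in\Gamma$ then $\Gamma\vdash x:\tau\langle\mu\rangle\alpha\langle\mu\rangle\alpha$; and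 $\Gamma\vdash n:\mathbb{N}\langle\mu\rangle\alpha\langle\mu\rangle\alpha$; - if $\Gamma,x:\tau_1\vdash e:\tau_2\langle\mu_\alpha\rangle\alpha\langle\mu_\beta\rangle\beta$ then $\Gamma\vdash\lambda x.e:(\tau_1\to\tau_2\langle\mu_\alpha\rangle\alpha\langle\mu_\beta\rangle\beta)\langle\mu_\gamma\rangle\gamma\langle\mu_\gamma\rangle\gamma$; - if $\Gamma\vdash e_1:(\tau_1\to\tau_2\langle\mu_\alpha\rangle\alpha\langle\mu_\beta\rangle\beta)\langle\mu_\gamma\rangle\gamma\langle\mu_\delta\rangle\delta$ and $\Gamma\vdash e_2:\tau_1\langle\mu_\beta\rangle\beta\langle\mu_\gamma\rangle\gamma$ then $\Gamma\vdash e_1e_2:\tau_2\langle\mu_\alpha\rangle\alpha\langle\mu_\delta\rangle\delta$; - if id-cont-type$(\gamma,\mu_{id},\gamma')$, compatible$((\tau_1\to\langle\mu_1\rangle\tau_2),\mu_2,\mu_0)$, compatible$(\mu_\beta,\mu_0,\mu_\alpha)$ and $\Gamma,k:\tau\to\tau_1\langle\mu_1\rangle\tau_2\langle\mu_2\rangle\alpha\vdash e:\gamma\langle\mu_{id}\rangle\gamma'\langle\bullet_\mu\rangle\beta$ then $\Gamma\vdash\mathcal{F}k.e:\tau\langle\mu_\alpha\rangle\alpha\langle\mu_\beta\rangle\beta$; - if id-cont-type$(\gamma,\mu_{id},\gamma')$ and $\Gamma\vdash e:\gamma\langle\mu_{id}\rangle\gamma'\langle\bullet_\mu\rangle\tau$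 then $\Gamma\vdash\langle e\rangle:\tau\langle\mu_\alpha\rangle\alpha\langle\mu_\alpha\rangle\alpha$. **System $\mathsf{4D}_{\mathsf{fun}}$ for control/prompt** (derived from the 2CPS interpreter with trails and functional meta continuations). Types $\tau,\alpha,\beta,\dots ::= \mathbb{N}\mid\tau_1\to\tau_2\,\langle\mu_\alpha,\sigma_\alpha\rangle\,\alpha\,\langle\mu_\beta,\sigma_\beta\rangle\,\beta$; trail types $\mu ::= \bullet_\mu\mid\tau_1\to\langle\mu,\sigma\rangle\,\tau_2$; meta continuation types $\sigma ::= \tau_1\to\tau_2$. Constraints: id-cont-type$(\tau,\bullet_\mu,(\tau_1\to\tau_1'),\tau')$ iff $\tau=\tau_1$, $\tau'=\tau_1'$; id-cont-type$(\tau,(\tau_1\to\langle\mu_1,\sigma_1\rangle\tau_1'),\sigma_2,\tau')$ iff $\tau=\tau_1$, $\tau'=\tau_1'$, $\mu_1=\bullet_\mu$, $\sigma_1=\sigma_2$. compatible$(\bullet_\mu,\mu_2,\mu_3)$ iff $\mu_2=\mu_3$; compatible$((\tau_1\to\langle\mu_1,\sigma_1\rangle\tau_1'),\bullet_\mu,\mu_3)$ iff $(\tau_1\to\langle\mu_1,\sigma_1\rangle\tau_1')=\mu_3$; compatible of two non-empty trail types and $\bullet_\mu$ is false; compatible$((\tau_1\to\langle\mu_1,\sigma_1\rangle\tau_1'),(\tau_2\to\langle\mu_2,\sigma_2\rangle\tau_2'),(\tau_3\to\langle\mu_3,\sigma_3\rangle\tau_3'))$ iff $\tau_1=\tau_3$,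 $\tau_1'=\tau_3'$, $\sigma_1=\sigma_3$ and compatible$((\tau_2\to\langle\mu_2,\sigma_2\rangle\tau_2'),\mu_3,\mu_1)$. Rules: - if $x:\tau\in\Gamma$ then $\Gamma\vdash x:\tau\langle\mu,\sigma\rangle\alpha\langle\mu,\sigma\rangle\alpha$; and $\Gamma\vdash n:\mathbb{N}\langle\mu,\sigma\rangle\alpha\langle\mu,\sigma\rangle\alpha$; - if $\Gamma,x:\tau_1\vdash e:\tau_2\langle\mu_\alpha,\sigma_\alpha\rangle\alpha\langle\mu_\beta,\sigma_\beta\rangle\beta$ then $\Gamma\vdash\lambda x.e:(\tau_1\to\tau_2\langle\mu_\alpha,\sigma_\alpha\rangle\alpha\langle\mu_\beta,\sigma_\beta\rangle\beta)\langle\mu_\gamma,\sigma_\gamma\rangle\gamma\langle\mu_\gamma,\sigma_\gamma\rangle\gamma$; - if $\Gamma\vdash e_1:(\tau_1\to\tau_2\langle\mu_\alpha,\sigma_\alpha\rangle\alpha\langle\mu_\beta,\sigma_\beta\rangle\beta)\langle\mu_\gamma,\sigma_\gamma\rangle\gamma\langle\mu_\delta,\sigma_\delta\rangle\delta$ and $\Gamma\vdash e_2:\tau_1\langle\mu_\beta,\sigma_\beta\rangle\beta\langle\mu_\gamma,\sigma_\gamma\rangle\gamma$ then $\Gamma\vdash e_1e_2:\tau_2\langle\mu_\alpha,\sigma_\alpha\rangle\alpha\langle\mu_\delta,\sigma_\delta\rangle\delta$; - if id-cont-type$(\gamma,\mu_{id},\sigma_{id},\gamma')$, compatible$((\tau_1\to\langle\mu_1,\sigma_1\rangle\tau_2),\mu_2,\mu_0)$,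 compatible$(\mu_\beta,\mu_0,\mu_\alpha)$ and $\Gamma,k:\tau\to\tau_1\langle\mu_1,\sigma_1\rangle\tau_2\langle\mu_2,\sigma_\alpha\rangle\alpha\vdash e:\gamma\langle\mu_{id},\sigma_{id}\rangle\gamma'\langle\bullet_\mu,\sigma_\beta\rangle\beta$ then $\Gamma\vdash\mathcal{F}k.e:\tau\langle\mu_\alpha,\sigma_\alpha\rangle\alpha\langle\mu_\beta,\sigma_\beta\rangle\beta$; - if id-cont-type$(\gamma,\mu_{id},\sigma_{id},\gamma')$ and $\Gamma\vdash e:\gamma\langle\mu_{id},\sigma_{id}\rangle\gamma'\langle\bullet_\mu,(\tau\to\alpha)\rangle\beta$ then $\Gamma\vdash\langle e\rangle:\tau\langle\mu_\alpha,\sigma_\alpha\rangle\alpha\langle\mu_\alpha,\sigma_\alpha\rangle\beta$. **Type translation** from $\mathsf{CP}$ to $\mathsf{4D}_{\mathsf{fun}}$ for a fixed $\mathsf{4D}_{\mathsf{fun}}$ type $\gamma$: $\mathbb{N}^{C,\gamma}=\mathbb{N}$; $(\tau_1\to\tau_2\langle\mu_1\rangle\alpha\langle\mu_2\rangle\beta)^{C,\gamma}=\tau_1^{C,\gamma}\to\tau_2^{C,\gamma}\,\langle\mu_1^{C,\gamma},(\alpha^{C,\gamma}\to\gamma)\rangle\,\gamma\,\langle\mu_2^{C,\gamma},(\beta^{C,\gamma}\to\gamma)\rangle\,\gamma$; $\bullet_\mu^{C,\gamma}=\bullet_\mu$; $(\tau_1\to\langle\mu\rangle\tau_2)^{C,\gamma}=\tau_1^{C,\gamma}\to\langle\mu^{C,\gamma},(\tau_2^{C,\gamma}\to\gamma)\rangle\,\gamma$;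 extended pointwise to type environments. *)

theory Defs
  imports Main
begin

type_synonym var = string

datatype trm =
    Num nat
  | Var var
  | Lam var trm
  | App trm trm
  | Control var trm
  | Prompt trm

text \<open>
  System CP (prefix \<open>c\<close>). \<open>CFun \<tau>\<^sub>1 \<tau>\<^sub>2 \<mu>\<^sub>\<alpha> \<alpha> \<mu>\<^sub>\<beta> \<beta>\<close> stands for
  \<open>\<tau>\<^sub>1 \<rightarrow> \<tau>\<^sub>2 \<langle>\<mu>\<^sub>\<alpha>\<rangle> \<alpha> \<langle>\<mu>\<^sub>\<beta>\<rangle> \<beta>\<close>, and \<open>CTrail \<tau>\<^sub>1 \<mu> \<tau>\<^sub>2\<close> for the trail type
  \<open>\<tau>\<^sub>1 \<rightarrow> \<langle>\<mu>\<rangle> \<tau>\<^sub>2\<close>.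
\<close>

datatype cty =
    CNat
  | CFun cty cty ctrail cty ctrail cty
and ctrail =
    CEmpty
  | CTrail cty ctrail cty

fun c_id_cont_type :: "cty \<Rightarrow> ctrail \<Rightarrow> cty \<Rightarrow> bool" where
  "c_id_cont_type \<tau> CEmpty \<tau>' \<longleftrightarrow> \<tau> = \<tau>'"
| "c_id_cont_type \<tau> (CTrail \<tau>\<^sub>1 \<mu>\<^sub>1 \<tau>\<^sub>1') \<tau>' \<longleftrightarrow> \<tau> = \<tau>\<^sub>1 \<and> \<tau>' = \<tau>\<^sub>1' \<and> \<mu>\<^sub>1 = CEmpty"

function c_compatible :: "ctrail \<Rightarrow> ctrail \<Rightarrow> ctrail \<Rightarrow> bool" where
  "c_compatible CEmpty \<mu>\<^sub>2 \<mu>\<^sub>3 \<longleftrightarrow> \<mu>\<^sub>2 = \<mu>\<^sub>3"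
| "c_compatible (CTrail \<tau>\<^sub>1 \<mu>\<^sub>1 \<tau>\<^sub>1') CEmpty \<mu>\<^sub>3 \<longleftrightarrow> CTrail \<tau>\<^sub>1 \<mu>\<^sub>1 \<tau>\<^sub>1' = \<mu>\<^sub>3"
| "c_compatible (CTrail \<tau>\<^sub>1 \<mu>\<^sub>1 \<tau>\<^sub>1') (CTrail \<tau>\<^sub>2 \<mu>\<^sub>2 \<tau>\<^sub>2') CEmpty \<longleftrightarrow> False"
| "c_compatible (CTrail \<tau>\<^sub>1 \<mu>\<^sub>1 \<tau>\<^sub>1') (CTrail \<tau>\<^sub>2 \<mu>\<^sub>2 \<tau>\<^sub>2') (CTrail \<tau>\<^sub>3 \<mu>\<^sub>3 \<tau>\<^sub>3') \<longleftrightarrow>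
     \<tau>\<^sub>1 = \<tau>\<^sub>3 \<and> \<tau>\<^sub>1' = \<tau>\<^sub>3' \<and> c_compatible (CTrail \<tau>\<^sub>2 \<mu>\<^sub>2 \<tau>\<^sub>2') \<mu>\<^sub>3 \<mu>\<^sub>1"
  by pat_completeness auto
termination
  by (relation "measure (\<lambda>(\<mu>\<^sub>1, \<mu>\<^sub>2, \<mu>\<^sub>3). size \<mu>\<^sub>1 + size \<mu>\<^sub>2 + size \<mu>\<^sub>3)") auto

text \<open>
  Environments are partial maps; \<open>\<Gamma>, x : \<tau>\<close> is the update \<open>\<Gamma>(x \<mapsto> \<tau>)\<close>, so an inner binder
  shadows an outer one of the same name. In \<open>c_control\<close> and \<open>c_prompt\<close>, \<open>\<mu>\<^sub>i\<close> is the
  trail type \<open>\<mu>\<^sub>i\<^sub>d\<close> of the identity continuation.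
\<close>

type_synonym cenv = "var \<rightharpoonup> cty"

inductive c_typing ::
    "cenv \<Rightarrow> trm \<Rightarrow> cty \<Rightarrow> ctrail \<Rightarrow> cty \<Rightarrow> ctrail \<Rightarrow> cty \<Rightarrow> bool"
    ("_ \<turnstile>\<^sub>C _ : _ \<langle>_\<rangle> _ \<langle>_\<rangle> _" [51, 51, 51, 0, 51, 0, 51] 50)
where
  c_var: "\<Gamma> x = Some \<tau> \<Longrightarrow> \<Gamma> \<turnstile>\<^sub>C Var x : \<tau> \<langle>\<mu>\<rangle> \<alpha> \<langle>\<mu>\<rangle> \<alpha>"
| c_num: "\<Gamma> \<turnstile>\<^sub>C Num n : CNat \<langle>\<mu>\<rangle> \<alpha> \<langle>\<mu>\<rangle> \<alpha>"
| c_lam: "\<Gamma>(x \<mapsto> \<tau>\<^sub>1) \<turnstile>\<^sub>C e : \<tau>\<^sub>2 \<langle>\<mu>\<^sub>\<alpha>\<rangle> \<alpha> \<langle>\<mu>\<^sub>\<beta>\<rangle> \<beta> \<Longrightarrow>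
    \<Gamma> \<turnstile>\<^sub>C Lam x e : CFun \<tau>\<^sub>1 \<tau>\<^sub>2 \<mu>\<^sub>\<alpha> \<alpha> \<mu>\<^sub>\<beta> \<beta> \<langle>\<mu>\<^sub>\<gamma>\<rangle> \<gamma> \<langle>\<mu>\<^sub>\<gamma>\<rangle> \<gamma>"
| c_app: "\<Gamma> \<turnstile>\<^sub>C e\<^sub>1 : CFun \<tau>\<^sub>1 \<tau>\<^sub>2 \<mu>\<^sub>\<alpha> \<alpha> \<mu>\<^sub>\<beta> \<beta> \<langle>\<mu>\<^sub>\<gamma>\<rangle> \<gamma> \<langle>\<mu>\<^sub>\<delta>\<rangle> \<delta> \<Longrightarrow>
    \<Gamma> \<turnstile>\<^sub>C e\<^sub>2 : \<tau>\<^sub>1 \<langle>\<mu>\<^sub>\<beta>\<rangle> \<beta> \<langle>\<mu>\<^sub>\<gamma>\<rangle> \<gamma> \<Longrightarrow>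
    \<Gamma> \<turnstile>\<^sub>C App e\<^sub>1 e\<^sub>2 : \<tau>\<^sub>2 \<langle>\<mu>\<^sub>\<alpha>\<rangle> \<alpha> \<langle>\<mu>\<^sub>\<delta>\<rangle> \<delta>"
| c_control: "c_id_cont_type \<gamma> \<mu>\<^sub>i \<gamma>' \<Longrightarrow>
    c_compatible (CTrail \<tau>\<^sub>1 \<mu>\<^sub>1 \<tau>\<^sub>2) \<mu>\<^sub>2 \<mu>\<^sub>0 \<Longrightarrow>
    c_compatible \<mu>\<^sub>\<beta> \<mu>\<^sub>0 \<mu>\<^sub>\<alpha> \<Longrightarrow>
    \<Gamma>(k \<mapsto> CFun \<tau> \<tau>\<^sub>1 \<mu>\<^sub>1 \<tau>\<^sub>2 \<mu>\<^sub>2 \<alpha>) \<turnstile>\<^sub>C e : \<gamma> \<langle>\<mu>\<^sub>i\<rangle> \<gamma>' \<langle>CEmpty\<rangle> \<beta> \<Longrightarrow>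
    \<Gamma> \<turnstile>\<^sub>C Control k e : \<tau> \<langle>\<mu>\<^sub>\<alpha>\<rangle> \<alpha> \<langle>\<mu>\<^sub>\<beta>\<rangle> \<beta>"
| c_prompt: "c_id_cont_type \<gamma> \<mu>\<^sub>i \<gamma>' \<Longrightarrow>
    \<Gamma> \<turnstile>\<^sub>C e : \<gamma> \<langle>\<mu>\<^sub>i\<rangle> \<gamma>' \<langle>CEmpty\<rangle> \<tau> \<Longrightarrow>
    \<Gamma> \<turnstile>\<^sub>C Prompt e : \<tau> \<langle>\<mu>\<^sub>\<alpha>\<rangle> \<alpha> \<langle>\<mu>\<^sub>\<alpha>\<rangle> \<alpha>"

text \<open>
  System 4D-fun for control/prompt (prefix \<open>d\<close>). \<open>DFun \<tau>\<^sub>1 \<tau>\<^sub>2 \<mu>\<^sub>\<alpha> \<sigma>\<^sub>\<alpha> \<alpha> \<mu>\<^sub>\<beta> \<sigma>\<^sub>\<beta> \<beta>\<close> stands for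
  \<open>\<tau>\<^sub>1 \<rightarrow> \<tau>\<^sub>2 \<langle>\<mu>\<^sub>\<alpha>, \<sigma>\<^sub>\<alpha>\<rangle> \<alpha> \<langle>\<mu>\<^sub>\<beta>, \<sigma>\<^sub>\<beta>\<rangle> \<beta>\<close>, \<open>DTrail \<tau>\<^sub>1 \<mu> \<sigma> \<tau>\<^sub>2\<close> for
  \<open>\<tau>\<^sub>1 \<rightarrow> \<langle>\<mu>, \<sigma>\<rangle> \<tau>\<^sub>2\<close>, and \<open>DMeta \<tau>\<^sub>1 \<tau>\<^sub>2\<close> for the meta continuation type
  \<open>\<tau>\<^sub>1 \<rightarrow> \<tau>\<^sub>2\<close>.
\<close>

datatype dty =
    DNat
  | DFun dty dty dtrail dmeta dty dtrail dmeta dty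
and dtrail =
    DEmpty
  | DTrail dty dtrail dmeta dty
and dmeta =
    DMeta dty dty

fun d_id_cont_type :: "dty \<Rightarrow> dtrail \<Rightarrow> dmeta \<Rightarrow> dty \<Rightarrow> bool" where
  "d_id_cont_type \<tau> DEmpty (DMeta \<tau>\<^sub>1 \<tau>\<^sub>1') \<tau>' \<longleftrightarrow> \<tau> = \<tau>\<^sub>1 \<and> \<tau>' = \<tau>\<^sub>1'"
| "d_id_cont_type \<tau> (DTrail \<tau>\<^sub>1 \<mu>\<^sub>1 \<sigma>\<^sub>1 \<tau>\<^sub>1') \<sigma>\<^sub>2 \<tau>' \<longleftrightarrow>
     \<tau> = \<tau>\<^sub>1 \<and> \<tau>' = \<tau>\<^sub>1' \<and> \<mu>\<^sub>1 = DEmpty \<and> \<sigma>\<^sub>1 = \<sigma>\<^sub>2"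

function d_compatible :: "dtrail \<Rightarrow> dtrail \<Rightarrow> dtrail \<Rightarrow> bool" where
  "d_compatible DEmpty \<mu>\<^sub>2 \<mu>\<^sub>3 \<longleftrightarrow> \<mu>\<^sub>2 = \<mu>\<^sub>3"
| "d_compatible (DTrail \<tau>\<^sub>1 \<mu>\<^sub>1 \<sigma>\<^sub>1 \<tau>\<^sub>1') DEmpty \<mu>\<^sub>3 \<longleftrightarrow> DTrail \<tau>\<^sub>1 \<mu>\<^sub>1 \<sigma>\<^sub>1 \<tau>\<^sub>1' = \<mu>\<^sub>3"
| "d_compatible (DTrail \<tau>\<^sub>1 \<mu>\<^sub>1 \<sigma>\<^sub>1 \<tau>\<^sub>1') (DTrail \<tau>\<^sub>2 \<mu>\<^sub>2 \<sigma>\<^sub>2 \<tau>\<^sub>2') DEmpty \<longleftrightarrow> False"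
| "d_compatible (DTrail \<tau>\<^sub>1 \<mu>\<^sub>1 \<sigma>\<^sub>1 \<tau>\<^sub>1') (DTrail \<tau>\<^sub>2 \<mu>\<^sub>2 \<sigma>\<^sub>2 \<tau>\<^sub>2') (DTrail \<tau>\<^sub>3 \<mu>\<^sub>3 \<sigma>\<^sub>3 \<tau>\<^sub>3') \<longleftrightarrow>
     \<tau>\<^sub>1 = \<tau>\<^sub>3 \<and> \<tau>\<^sub>1' = \<tau>\<^sub>3' \<and> \<sigma>\<^sub>1 = \<sigma>\<^sub>3 \<and>
     d_compatible (DTrail \<tau>\<^sub>2 \<mu>\<^sub>2 \<sigma>\<^sub>2 \<tau>\<^sub>2') \<mu>\<^sub>3 \<mu>\<^sub>1"
  by pat_completeness auto
termination
  by (relation "measure (\<lambda>(\<mu>\<^sub>1, \<mu>\<^sub>2, \<mu>\<^sub>3). size \<mu>\<^sub>1 + size \<mu>\<^sub>2 + size \<mu>\<^sub>3)") auto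

type_synonym denv = "var \<rightharpoonup> dty"

inductive d_typing ::
    "denv \<Rightarrow> trm \<Rightarrow> dty \<Rightarrow> dtrail \<Rightarrow> dmeta \<Rightarrow> dty \<Rightarrow> dtrail \<Rightarrow> dmeta \<Rightarrow> dty \<Rightarrow> bool"
    ("_ \<turnstile>\<^sub>D _ : _ \<langle>_, _\<rangle> _ \<langle>_, _\<rangle> _" [51, 51, 51, 0, 0, 51, 0, 0, 51] 50)
where
  d_var: "\<Gamma> x = Some \<tau> \<Longrightarrow> \<Gamma> \<turnstile>\<^sub>D Var x : \<tau> \<langle>\<mu>, \<sigma>\<rangle> \<alpha> \<langle>\<mu>, \<sigma>\<rangle> \<alpha>"
| d_num: "\<Gamma> \<turnstile>\<^sub>D Num n : DNat \<langle>\<mu>, \<sigma>\<rangle> \<alpha> \<langle>\<mu>, \<sigma>\<rangle> \<alpha>"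
| d_lam: "\<Gamma>(x \<mapsto> \<tau>\<^sub>1) \<turnstile>\<^sub>D e : \<tau>\<^sub>2 \<langle>\<mu>\<^sub>\<alpha>, \<sigma>\<^sub>\<alpha>\<rangle> \<alpha> \<langle>\<mu>\<^sub>\<beta>, \<sigma>\<^sub>\<beta>\<rangle> \<beta> \<Longrightarrow>
    \<Gamma> \<turnstile>\<^sub>D Lam x e : DFun \<tau>\<^sub>1 \<tau>\<^sub>2 \<mu>\<^sub>\<alpha> \<sigma>\<^sub>\<alpha> \<alpha> \<mu>\<^sub>\<beta> \<sigma>\<^sub>\<beta> \<beta> \<langle>\<mu>\<^sub>\<gamma>, \<sigma>\<^sub>\<gamma>\<rangle> \<gamma> \<langle>\<mu>\<^sub>\<gamma>, \<sigma>\<^sub>\<gamma>\<rangle> \<gamma>"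
| d_app: "\<Gamma> \<turnstile>\<^sub>D e\<^sub>1 : DFun \<tau>\<^sub>1 \<tau>\<^sub>2 \<mu>\<^sub>\<alpha> \<sigma>\<^sub>\<alpha> \<alpha> \<mu>\<^sub>\<beta> \<sigma>\<^sub>\<beta> \<beta> \<langle>\<mu>\<^sub>\<gamma>, \<sigma>\<^sub>\<gamma>\<rangle> \<gamma> \<langle>\<mu>\<^sub>\<delta>, \<sigma>\<^sub>\<delta>\<rangle> \<delta> \<Longrightarrow>
    \<Gamma> \<turnstile>\<^sub>D e\<^sub>2 : \<tau>\<^sub>1 \<langle>\<mu>\<^sub>\<beta>, \<sigma>\<^sub>\<beta>\<rangle> \<beta> \<langle>\<mu>\<^sub>\<gamma>, \<sigma>\<^sub>\<gamma>\<rangle> \<gamma> \<Longrightarrow>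
    \<Gamma> \<turnstile>\<^sub>D App e\<^sub>1 e\<^sub>2 : \<tau>\<^sub>2 \<langle>\<mu>\<^sub>\<alpha>, \<sigma>\<^sub>\<alpha>\<rangle> \<alpha> \<langle>\<mu>\<^sub>\<delta>, \<sigma>\<^sub>\<delta>\<rangle> \<delta>"
| d_control: "d_id_cont_type \<gamma> \<mu>\<^sub>i \<sigma>\<^sub>i \<gamma>' \<Longrightarrow>
    d_compatible (DTrail \<tau>\<^sub>1 \<mu>\<^sub>1 \<sigma>\<^sub>1 \<tau>\<^sub>2) \<mu>\<^sub>2 \<mu>\<^sub>0 \<Longrightarrow>
    d_compatible \<mu>\<^sub>\<beta> \<mu>\<^sub>0 \<mu>\<^sub>\<alpha> \<Longrightarrow>
    \<Gamma>(k \<mapsto> DFun \<tau> \<tau>\<^sub>1 \<mu>\<^sub>1 \<sigma>\<^sub>1 \<tau>\<^sub>2 \<mu>\<^sub>2 \<sigma>\<^sub>\<alpha> \<alpha>) \<turnstile>\<^sub>D e : \<gamma> \<langle>\<mu>\<^sub>i, \<sigma>\<^sub>i\<rangle> \<gamma>' \<langle>DEmpty, \<sigma>\<^sub>\<beta>\<rangle> \<beta> \<Longrightarrow>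
    \<Gamma> \<turnstile>\<^sub>D Control k e : \<tau> \<langle>\<mu>\<^sub>\<alpha>, \<sigma>\<^sub>\<alpha>\<rangle> \<alpha> \<langle>\<mu>\<^sub>\<beta>, \<sigma>\<^sub>\<beta>\<rangle> \<beta>"
| d_prompt: "d_id_cont_type \<gamma> \<mu>\<^sub>i \<sigma>\<^sub>i \<gamma>' \<Longrightarrow>
    \<Gamma> \<turnstile>\<^sub>D e : \<gamma> \<langle>\<mu>\<^sub>i, \<sigma>\<^sub>i\<rangle> \<gamma>' \<langle>DEmpty, DMeta \<tau> \<alpha>\<rangle> \<beta> \<Longrightarrow>
    \<Gamma> \<turnstile>\<^sub>D Prompt e : \<tau> \<langle>\<mu>\<^sub>\<alpha>, \<sigma>\<^sub>\<alpha>\<rangle> \<alpha> \<langle>\<mu>\<^sub>\<alpha>, \<sigma>\<^sub>\<alpha>\<rangle> \<beta>"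

primrec trans_ty :: "dty \<Rightarrow> cty \<Rightarrow> dty"
  and trans_trail :: "dty \<Rightarrow> ctrail \<Rightarrow> dtrail"
where
  "trans_ty \<gamma> CNat = DNat"
| "trans_ty \<gamma> (CFun \<tau>\<^sub>1 \<tau>\<^sub>2 \<mu>\<^sub>1 \<alpha> \<mu>\<^sub>2 \<beta>) =
     DFun (trans_ty \<gamma> \<tau>\<^sub>1) (trans_ty \<gamma> \<tau>\<^sub>2)
       (trans_trail \<gamma> \<mu>\<^sub>1) (DMeta (trans_ty \<gamma> \<alpha>) \<gamma>) \<gamma>
       (trans_trail \<gamma> \<mu>\<^sub>2) (DMeta (trans_ty \<gamma> \<beta>) \<gamma>) \<gamma>"
| "trans_trail \<gamma> CEmpty = DEmpty"
| "trans_trail \<gamma> (CTrail \<tau>\<^sub>1 \<mu> \<tau>\<^sub>2) =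
     DTrail (trans_ty \<gamma> \<tau>\<^sub>1) (trans_trail \<gamma> \<mu>) (DMeta (trans_ty \<gamma> \<tau>\<^sub>2) \<gamma>) \<gamma>"

definition trans_env :: "dty \<Rightarrow> cenv \<Rightarrow> denv" where
  "trans_env \<gamma> \<Gamma> = (\<lambda>x. map_option (trans_ty \<gamma>) (\<Gamma> x))"

end

theory Submission
  imports Defs
begin

text \<open>
  The translation is a section of an erasure map from 4D-fun types to CP types that replaces
  each pair of a meta continuation type \<open>\<tau>\<^sub>1 \<rightarrow> \<tau>\<^sub>2\<close> and its answer type by \<open>\<tau>\<^sub>1\<close>. Erasure
  turns every 4D-fun derivation into a CP derivation, even when the derivation passes through
  types outside the image of the translation; this gives (2).
\<close>

primrec erase_ty :: "dty \<Rightarrow> cty"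
  and erase_trail :: "dtrail \<Rightarrow> ctrail"
  and erase_meta :: "dmeta \<Rightarrow> cty"
where
  "erase_ty DNat = CNat"
| "erase_ty (DFun \<tau>\<^sub>1 \<tau>\<^sub>2 \<mu>\<^sub>\<alpha> \<sigma>\<^sub>\<alpha> \<alpha> \<mu>\<^sub>\<beta> \<sigma>\<^sub>\<beta> \<beta>) =
     CFun (erase_ty \<tau>\<^sub>1) (erase_ty \<tau>\<^sub>2) (erase_trail \<mu>\<^sub>\<alpha>) (erase_meta \<sigma>\<^sub>\<alpha>)
       (erase_trail \<mu>\<^sub>\<beta>) (erase_meta \<sigma>\<^sub>\<beta>)"
| "erase_trail DEmpty = CEmpty"
| "erase_trail (DTrail \<tau>\<^sub>1 \<mu> \<sigma> \<tau>\<^sub>2) = CTrail (erase_ty \<tau>\<^sub>1) (erase_trail \<mu>) (erase_meta \<sigma>)"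
| "erase_meta (DMeta \<tau>\<^sub>1 \<tau>\<^sub>2) = erase_ty \<tau>\<^sub>1"

definition erase_env :: "denv \<Rightarrow> cenv" where
  "erase_env \<Gamma> = (\<lambda>x. map_option erase_ty (\<Gamma> x))"

text \<open>The translation inserts \<open>\<gamma>\<close> only as the codomain of a meta
  continuation type or as the answer type beside it, and erasure drops both positions.\<close>

lemma erase_trans [simp]:
  "erase_ty (trans_ty \<gamma> \<tau>) = \<tau>"
  "erase_trail (trans_trail \<gamma> \<mu>) = \<mu>"
  by (induction \<tau> and \<mu>) auto

lemma erase_trans_env [simp]: "erase_env (trans_env \<gamma> \<Gamma>) = \<Gamma>"
  by (simp add: erase_env_def trans_env_def option.map_comp comp_def option.map_ident)

lemma erase_env_upd [simp]: "erase_env (\<Gamma>(x \<mapsto> \<tau>)) = (erase_env \<Gamma>)(x \<mapsto> erase_ty \<tau>)"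
  by (auto simp: erase_env_def)

lemma trans_env_upd [simp]: "trans_env \<gamma> (\<Gamma>(x \<mapsto> \<tau>)) = (trans_env \<gamma> \<Gamma>)(x \<mapsto> trans_ty \<gamma> \<tau>)"
  by (auto simp: trans_env_def)

text \<open>The CP answer type is read off \<open>\<sigma>\<close>, not \<open>\<tau>'\<close>. For
  an empty trail the domain of \<open>\<sigma>\<close> must equal \<open>\<tau>\<close>; otherwise
  the equation between the two meta continuation types erases to the required equation of answer
  types.\<close>

lemma erase_id_cont_type:
  "d_id_cont_type \<tau> \<mu> \<sigma> \<tau>' \<Longrightarrow> c_id_cont_type (erase_ty \<tau>) (erase_trail \<mu>) (erase_meta \<sigma>)"
  by (induction \<tau> \<mu> \<sigma> \<tau>' rule: d_id_cont_type.induct) auto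

text \<open>Both functions recurse in the same way, and each 4D-fun equation survives erasure;
  \<open>\<sigma>\<^sub>1 = \<sigma>\<^sub>3\<close> supplies the equation of CP answer types. The
  converse fails, since erasure is not injective.\<close>

lemma erase_compatible:
  "d_compatible \<mu>\<^sub>1 \<mu>\<^sub>2 \<mu>\<^sub>3 \<Longrightarrow>
    c_compatible (erase_trail \<mu>\<^sub>1) (erase_trail \<mu>\<^sub>2) (erase_trail \<mu>\<^sub>3)"
  by (induction \<mu>\<^sub>1 \<mu>\<^sub>2 \<mu>\<^sub>3 rule: d_compatible.induct) auto

lemma trans_id_cont_type:
  "c_id_cont_type \<tau> \<mu> \<tau>' \<Longrightarrow>
    d_id_cont_type (trans_ty \<gamma> \<tau>) (trans_trail \<gamma> \<mu>) (DMeta (trans_ty \<gamma> \<tau>') \<gamma>) \<gamma>"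
  by (induction \<tau> \<mu> \<tau>' rule: c_id_cont_type.induct) auto

lemma trans_compatible:
  "c_compatible \<mu>\<^sub>1 \<mu>\<^sub>2 \<mu>\<^sub>3 \<Longrightarrow>
    d_compatible (trans_trail \<gamma> \<mu>\<^sub>1) (trans_trail \<gamma> \<mu>\<^sub>2) (trans_trail \<gamma> \<mu>\<^sub>3)"
  by (induction \<mu>\<^sub>1 \<mu>\<^sub>2 \<mu>\<^sub>3 rule: c_compatible.induct) auto

text \<open>Stated for arbitrary 4D-fun types because rules such as application have premises with
  types absent from the conclusion, which need not be translations.\<close>

lemma erase_typing:
  "\<Gamma> \<turnstile>\<^sub>D e : \<tau> \<langle>\<mu>\<^sub>\<alpha>, \<sigma>\<^sub>\<alpha>\<rangle> \<alpha> \<langle>\<mu>\<^sub>\<beta>, \<sigma>\<^sub>\<beta>\<rangle> \<beta> \<Longrightarrow>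
    erase_env \<Gamma> \<turnstile>\<^sub>C e : erase_ty \<tau> \<langle>erase_trail \<mu>\<^sub>\<alpha>\<rangle> erase_meta \<sigma>\<^sub>\<alpha>
      \<langle>erase_trail \<mu>\<^sub>\<beta>\<rangle> erase_meta \<sigma>\<^sub>\<beta>"
proof (induction rule: d_typing.induct)
  case (d_var \<Gamma> x \<tau> \<mu> \<sigma> \<alpha>)
  then show ?case by (auto simp: erase_env_def intro: c_typing.intros)
next
  case (d_control \<gamma> \<mu>\<^sub>i \<sigma>\<^sub>i \<gamma>' \<tau>\<^sub>1 \<mu>\<^sub>1 \<sigma>\<^sub>1 \<tau>\<^sub>2 \<mu>\<^sub>2 \<mu>\<^sub>0 \<mu>\<^sub>\<beta> \<mu>\<^sub>\<alpha> \<Gamma> k \<tau> \<sigma>\<^sub>\<alpha> \<alpha> e \<sigma>\<^sub>\<beta> \<beta>)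
  show ?case
  proof (rule c_typing.c_control)
    \<comment> \<open>This fixes the types that occur only in the premises of the rule: the captured
      continuation gets the erasure of \<open>\<sigma>\<^sub>1\<close> as its answer type.\<close>
    show "c_compatible (CTrail (erase_ty \<tau>\<^sub>1) (erase_trail \<mu>\<^sub>1) (erase_meta \<sigma>\<^sub>1))
        (erase_trail \<mu>\<^sub>2) (erase_trail \<mu>\<^sub>0)"
      using erase_compatible[OF d_control.hyps(2)] by simp
  qed (use d_control in \<open>auto intro: erase_id_cont_type erase_compatible simp del: fun_upd_apply\<close>)
next
  case (d_prompt \<gamma> \<mu>\<^sub>i \<sigma>\<^sub>i \<gamma>' \<Gamma> e \<tau> \<alpha> \<beta> \<mu>\<^sub>\<alpha> \<sigma>\<^sub>\<alpha>)
  then show ?case by (auto intro: c_typing.c_prompt erase_id_cont_type)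
qed (auto intro: c_typing.intros simp del: fun_upd_apply)

text \<open>Every 4D-fun answer type is chosen to be \<open>\<gamma>\<close>, and the CP answer
  types become domains of meta continuation types. For a prompt, the body then runs under a meta
  continuation from the translated result type to \<open>\<gamma>\<close>.\<close>

lemma trans_typing:
  "\<Gamma> \<turnstile>\<^sub>C e : \<tau> \<langle>\<mu>\<^sub>\<alpha>\<rangle> \<alpha> \<langle>\<mu>\<^sub>\<beta>\<rangle> \<beta> \<Longrightarrow>
    trans_env \<gamma> \<Gamma> \<turnstile>\<^sub>D e : trans_ty \<gamma> \<tau>
      \<langle>trans_trail \<gamma> \<mu>\<^sub>\<alpha>, DMeta (trans_ty \<gamma> \<alpha>) \<gamma>\<rangle> \<gamma>
      \<langle>trans_trail \<gamma> \<mu>\<^sub>\<beta>, DMeta (trans_ty \<gamma> \<beta>) \<gamma>\<rangle> \<gamma>"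
proof (induction rule: c_typing.induct)
  case (c_var \<Gamma> x \<tau> \<mu> \<alpha>)
  then show ?case by (auto simp: trans_env_def intro: d_typing.intros)
next
  case (c_control \<delta> \<mu>\<^sub>i \<delta>' \<tau>\<^sub>1 \<mu>\<^sub>1 \<tau>\<^sub>2 \<mu>\<^sub>2 \<mu>\<^sub>0 \<mu>\<^sub>\<beta> \<mu>\<^sub>\<alpha> \<Gamma> k \<tau> \<alpha> e \<beta>)
  show ?case
  proof (rule d_typing.d_control)
    show "d_compatible
        (DTrail (trans_ty \<gamma> \<tau>\<^sub>1) (trans_trail \<gamma> \<mu>\<^sub>1) (DMeta (trans_ty \<gamma> \<tau>\<^sub>2) \<gamma>) \<gamma>)
        (trans_trail \<gamma> \<mu>\<^sub>2) (trans_trail \<gamma> \<mu>\<^sub>0)"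
      using trans_compatible[OF c_control.hyps(2)] by simp
  qed (use c_control in \<open>auto intro: trans_id_cont_type trans_compatible simp del: fun_upd_apply\<close>)
next
  case (c_prompt \<delta> \<mu>\<^sub>i \<delta>' \<Gamma> e \<tau> \<mu>\<^sub>\<alpha> \<alpha>)
  then show ?case by (auto intro: d_typing.d_prompt trans_id_cont_type)
qed (auto intro: d_typing.intros simp del: fun_upd_apply)

theorem theorem5p4:
  fixes e :: trm and \<tau> \<alpha> \<beta> :: cty and \<mu>\<^sub>1 \<mu>\<^sub>2 :: ctrail and \<Gamma> :: cenv
  shows
    "(\<Gamma> \<turnstile>\<^sub>C e : \<tau> \<langle>\<mu>\<^sub>1\<rangle> \<alpha> \<langle>\<mu>\<^sub>2\<rangle> \<beta> \<longrightarrow>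
       (\<forall>\<gamma> :: dty.
          trans_env \<gamma> \<Gamma> \<turnstile>\<^sub>D e : trans_ty \<gamma> \<tau>
            \<langle>trans_trail \<gamma> \<mu>\<^sub>1, DMeta (trans_ty \<gamma> \<alpha>) \<gamma>\<rangle> \<gamma>
            \<langle>trans_trail \<gamma> \<mu>\<^sub>2, DMeta (trans_ty \<gamma> \<beta>) \<gamma>\<rangle> \<gamma>)) \<and>
     ((\<exists>\<gamma> :: dty.
          trans_env \<gamma> \<Gamma> \<turnstile>\<^sub>D e : trans_ty \<gamma> \<tau>
            \<langle>trans_trail \<gamma> \<mu>\<^sub>1, DMeta (trans_ty \<gamma> \<alpha>) \<gamma>\<rangle> \<gamma>
            \<langle>trans_trail \<gamma> \<mu>\<^sub>2, DMeta (trans_ty \<gamma> \<beta>) \<gamma>\<rangle> \<gamma>) \<longrightarrow>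
       \<Gamma> \<turnstile>\<^sub>C e : \<tau> \<langle>\<mu>\<^sub>1\<rangle> \<alpha> \<langle>\<mu>\<^sub>2\<rangle> \<beta>)"
proof -
  have "\<Gamma> \<turnstile>\<^sub>C e : \<tau> \<langle>\<mu>\<^sub>1\<rangle> \<alpha> \<langle>\<mu>\<^sub>2\<rangle> \<beta>"
    if "trans_env \<gamma> \<Gamma> \<turnstile>\<^sub>D e : trans_ty \<gamma> \<tau>
      \<langle>trans_trail \<gamma> \<mu>\<^sub>1, DMeta (trans_ty \<gamma> \<alpha>) \<gamma>\<rangle> \<gamma>
      \<langle>trans_trail \<gamma> \<mu>\<^sub>2, DMeta (trans_ty \<gamma> \<beta>) \<gamma>\<rangle> \<gamma>" for \<gamma>
    \<comment> \<open>Erasing the translated judgment restores the CP judgment, by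
      \<open>erase_trans\<close> and \<open>erase_trans_env\<close>.\<close>
    using erase_typing[OF that] by simp
  then show ?thesis by (blast intro: trans_typing)
qed

end
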